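(* Let $n\geq 1$ and let $f:\{0,1\}^n\to\{0,1\}$ be a boolean function. Then $f$ is matchgate-computable with probability $p>\frac34$ (that is, there exists $p>\frac34$ such that $f$ is matchgate-computable with probability at least $p$) if and only if $f$ is either constant or depends on a single bit of its input.
   Context: Matchgates. A matchgate is a two-qubit unitary $G$ whose matrix in the standard basis $|00\rangle,|01\rangle,|10\rangle,|11\rangle$ is $$G=\begin{pmatrix} a & 0 & 0 & b \\ 0 & u & v & 0 \\ 0 & x & y & 0 \\ c & 0 & 0 & d \end{pmatrix},\quad \begin{pmatrix} a & b \\ c & d \end{pmatrix}\in SU(2),\quad \begin{pmatrix} u & v \\ x & y \end{pmatrix}\in SU(2).$$ A matchgate circuit on $m$ qubits (arranged on a line $1,\dots,m$) is a unitary that is a finite product of matchgates, each acting on a pair of nearest-neighbor qubits $(k,k+1)$. Global phases are irrelevant. No bound is placed on the number of gates. Computability. Let $U$ be an $m$-qubit unitary with $m\geq n$. $U$ computes $f$ with probability at least $p$ if for every $x\in\{0,1\}^n$, preparing $U|x,0\rangle$ (where $0$ denotes a string of $m-n$ zeros) and measuring the first qubit in the computational basis yields outcome $f(x)$ with probability at least $p$. $f$ is matchgate-computable with probability at least $p$ if for some $m\geq n$ there is a matchgate circuit on $m$ qubits that computes $f$ with probability at least $p$ (no restriction on the size of $m$). Dependence on bits. $f$ depends on its $k$-th variable if there exists $x\in\{0,1\}^n$ with $f(x)\neq f(x_{\neg k})$, where $x_{\neg k}$ is obtained from $x$ by flipping its $k$-th bit. $f$ depends on a single bit of its input if there is exactly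 one such $k$, i.e. $f(x)=x_k$ for all $x$ or $f(x)=1-x_k$ for all $x$. *)

theory Defs
  imports "Jordan_Normal_Form.Schur_Decomposition"
begin

text \<open>
  Qubits of an \<open>m\<close>-qubit register and variables of a boolean function are numbered from \<open>0\<close>.
  A bit string is a \<^typ>\<open>bool list\<close>; a boolean function of \<open>n\<close> variables is a function on bit
  strings, of which only the values on strings of length \<open>n\<close> matter.
\<close>

fun basis_index :: "bool list \<Rightarrow> nat" where
  "basis_index [] = 0"
| "basis_index (b # bs) = of_bool b * 2 ^ length bs + basis_index bs"

text \<open>
  The first bit is the most significant one, so that the order of the basis is
  \<open>|00>, |01>, |10>, |11>\<close> and the space of an \<open>m\<close>-qubit register is the Kronecker product of
  its qubits, taken from left to right.
\<close>

definition ket :: "bool list \<Rightarrow> complex vec" where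
  "ket xs = unit_vec (2 ^ length xs) (basis_index xs)"

definition kron :: "complex mat \<Rightarrow> complex mat \<Rightarrow> complex mat"  (infixl \<open>\<otimes>\<^sub>k\<close> 70) where
  "A \<otimes>\<^sub>k B = mat (dim_row A * dim_row B) (dim_col A * dim_col B)
     (\<lambda>(i, j). A $$ (i div dim_row B, j div dim_col B) * B $$ (i mod dim_row B, j mod dim_col B))"

definition unitary_mat :: "nat \<Rightarrow> complex mat \<Rightarrow> bool" where
  "unitary_mat N A \<longleftrightarrow> A \<in> carrier_mat N N \<and> A * mat_adjoint A = 1\<^sub>m N"

definition SU2 :: "complex mat set" where
  "SU2 = {A. unitary_mat 2 A \<and> det A = 1}"

definition matchgate :: "complex mat \<Rightarrow> bool" where
  "matchgate G \<longleftrightarrow> (\<exists>a b c d u v x y.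
     G = mat_of_rows_list 4
       [[a, 0, 0, b],
        [0, u, v, 0],
        [0, x, y, 0],
        [c, 0, 0, d]] \<and>
     mat_of_rows_list 2 [[a, b], [c, d]] \<in> SU2 \<and>
     mat_of_rows_list 2 [[u, v], [x, y]] \<in> SU2)"

text \<open>
  The gate acts on the adjacent qubits \<open>k\<close> and \<open>k + 1\<close> (counted from \<open>0\<close>, \<open>k + 1 < m\<close>).
  Global phases are not factored out, since they do not affect measurement outcomes.
\<close>

definition on_neighbours :: "nat \<Rightarrow> nat \<Rightarrow> complex mat \<Rightarrow> complex mat" where
  "on_neighbours m k G = 1\<^sub>m (2 ^ k) \<otimes>\<^sub>k G \<otimes>\<^sub>k 1\<^sub>m (2 ^ (m - k - 2))"

inductive matchgate_circuit :: "nat \<Rightarrow> complex mat \<Rightarrow> bool" for m :: nat where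
  empty: "matchgate_circuit m (1\<^sub>m (2 ^ m))"
| gate: "matchgate G \<Longrightarrow> k + 1 < m \<Longrightarrow> matchgate_circuit m U \<Longrightarrow>
    matchgate_circuit m (on_neighbours m k G * U)"

definition prob_first :: "nat \<Rightarrow> complex vec \<Rightarrow> bool \<Rightarrow> real" where
  "prob_first m \<psi> b =
     (\<Sum>ys | length ys = m \<and> hd ys = b. (cmod (\<psi> $ basis_index ys))\<^sup>2)"

definition computes :: "nat \<Rightarrow> nat \<Rightarrow> complex mat \<Rightarrow> (bool list \<Rightarrow> bool) \<Rightarrow> real \<Rightarrow> bool" where
  "computes n m U f p \<longleftrightarrow>
     (\<forall>xs. length xs = n \<longrightarrow>
        prob_first m (U *\<^sub>v ket (xs @ replicate (m - n) False)) (f xs) \<ge> p)"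

definition matchgate_computable :: "nat \<Rightarrow> (bool list \<Rightarrow> bool) \<Rightarrow> real \<Rightarrow> bool" where
  "matchgate_computable n f p \<longleftrightarrow>
     (\<exists>m U. n \<le> m \<and> matchgate_circuit m U \<and> computes n m U f p)"

definition depends_on :: "nat \<Rightarrow> (bool list \<Rightarrow> bool) \<Rightarrow> nat \<Rightarrow> bool" where
  "depends_on n f k \<longleftrightarrow> k < n \<and> (\<exists>xs. length xs = n \<and> f xs \<noteq> f (xs[k := \<not> xs ! k]))"

definition constant_function :: "nat \<Rightarrow> (bool list \<Rightarrow> bool) \<Rightarrow> bool" where
  "constant_function n f \<longleftrightarrow> (\<exists>c. \<forall>xs. length xs = n \<longrightarrow> f xs = c)"

definition depends_on_single_bit :: "nat \<Rightarrow> (bool list \<Rightarrow> bool) \<Rightarrow> bool" where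
  "depends_on_single_bit n f \<longleftrightarrow> (\<exists>!k. depends_on n f k)"


text \<open>Matchgate circuits are unitary, although this is not part of their definition.\<close>

lemma dim_kron [simp]:
  "dim_row (A \<otimes>\<^sub>k B) = dim_row A * dim_row B"
  "dim_col (A \<otimes>\<^sub>k B) = dim_col A * dim_col B"
  by (simp_all add: kron_def)

lemma index_mat_adjoint:
  fixes A :: "complex mat"
  assumes "i < dim_col A" "j < dim_row A"
  shows "mat_adjoint A $$ (i, j) = cnj (A $$ (j, i))"
  using assms by (simp add: mat_adjoint_def mat_of_rows_def)

lemma dim_mat_adjoint [simp]:
  fixes A :: "complex mat"
  shows "dim_row (mat_adjoint A) = dim_col A" "dim_col (mat_adjoint A) = dim_row A"
  by (simp_all add: mat_adjoint_def mat_of_rows_def)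

lemma mat_adjoint_kron: "mat_adjoint (A \<otimes>\<^sub>k B) = mat_adjoint A \<otimes>\<^sub>k mat_adjoint B"
proof (rule eq_matI)
  fix i j
  assume "i < dim_row (mat_adjoint A \<otimes>\<^sub>k mat_adjoint B)"
    and "j < dim_col (mat_adjoint A \<otimes>\<^sub>k mat_adjoint B)"
  then have ij: "i < dim_col A * dim_col B" "j < dim_row A * dim_row B"
    by simp_all
  then have pos: "0 < dim_col B" "0 < dim_row B"
    by (auto intro: gr0I)
  have "i div dim_col B < dim_col A" "j div dim_row B < dim_row A"
    using ij by (simp_all add: less_mult_imp_div_less)
  then show "mat_adjoint (A \<otimes>\<^sub>k B) $$ (i, j) = (mat_adjoint A \<otimes>\<^sub>k mat_adjoint B) $$ (i, j)"
    using ij pos by (simp add: index_mat_adjoint) (simp add: kron_def index_mat_adjoint)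
qed simp_all

lemma sum_div_mod:
  fixes f g :: "nat \<Rightarrow> complex"
  shows "(\<Sum>k<a * b. f (k div b) * g (k mod b)) = (\<Sum>k<a. f k) * (\<Sum>k<b. g k)"
proof (induction a)
  case (Suc a)
  have "(\<Sum>k<N + b. h k) = (\<Sum>k<N. h k) + (\<Sum>k<b. h (N + k))"
    for N and h :: "nat \<Rightarrow> complex"
    by (induction b) (simp_all add: add.assoc)
  then have "(\<Sum>k<a * b + b. f (k div b) * g (k mod b)) =
    (\<Sum>k<a * b. f (k div b) * g (k mod b)) +
    (\<Sum>k<b. f ((a * b + k) div b) * g ((a * b + k) mod b))"
    by blast
  also have "(\<Sum>k<b. f ((a * b + k) div b) * g ((a * b + k) mod b)) = (\<Sum>k<b. f a * g k)"
    by (rule sum.cong) auto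
  also have "\<dots> = f a * (\<Sum>k<b. g k)"
    by (rule sum_distrib_left[symmetric])
  finally have "(\<Sum>k<a * b + b. f (k div b) * g (k mod b)) =
    (\<Sum>k<Suc a. f k) * (\<Sum>k<b. g k)"
    by (simp only: Suc.IH sum.lessThan_Suc distrib_right)
  then show ?case
    by (simp only: mult_Suc add.commute[of b "a * b"])
qed simp

lemma kron_mult_kron:
  assumes "dim_col A = dim_row C" "dim_col B = dim_row D"
  shows "(A \<otimes>\<^sub>k B) * (C \<otimes>\<^sub>k D) = (A * C) \<otimes>\<^sub>k (B * D)"
proof (rule eq_matI)
  fix i j
  assume "i < dim_row ((A * C) \<otimes>\<^sub>k (B * D))" "j < dim_col ((A * C) \<otimes>\<^sub>k (B * D))"
  then have ij: "i < dim_row A * dim_row B" "j < dim_col C * dim_col D"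
    by simp_all
  then have pos: "0 < dim_row B" "0 < dim_col D"
    by (auto intro: gr0I)
  have dv: "i div dim_row B < dim_row A" "j div dim_col D < dim_col C"
    using ij by (simp_all add: less_mult_imp_div_less)
  have "((A \<otimes>\<^sub>k B) * (C \<otimes>\<^sub>k D)) $$ (i, j) =
    (\<Sum>k<dim_row C * dim_row D.
      (A $$ (i div dim_row B, k div dim_row D) * C $$ (k div dim_row D, j div dim_col D)) *
      (B $$ (i mod dim_row B, k mod dim_row D) * D $$ (k mod dim_row D, j mod dim_col D)))"
    using ij assms by (simp add: scalar_prod_def kron_def lessThan_atLeast0 mult_ac)
  also have "\<dots> = ((A * C) \<otimes>\<^sub>k (B * D)) $$ (i, j)"
    using ij dv pos assms
    by (simp only: sum_div_mod[where f = "\<lambda>k. A $$ (i div dim_row B, k) * C $$ (k, j div dim_col D)"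
          and g = "\<lambda>k. B $$ (i mod dim_row B, k) * D $$ (k, j mod dim_col D)"])
      (simp add: scalar_prod_def kron_def lessThan_atLeast0)
  finally show "((A \<otimes>\<^sub>k B) * (C \<otimes>\<^sub>k D)) $$ (i, j) = ((A * C) \<otimes>\<^sub>k (B * D)) $$ (i, j)" .
qed simp_all

lemma kron_one: "1\<^sub>m a \<otimes>\<^sub>k 1\<^sub>m b = 1\<^sub>m (a * b)"
proof (rule eq_matI)
  fix i j
  assume "i < dim_row (1\<^sub>m (a * b) :: complex mat)" "j < dim_col (1\<^sub>m (a * b) :: complex mat)"
  then have ij: "i < a * b" "j < a * b"
    by simp_all
  then have "0 < b"
    by (auto intro: gr0I)
  moreover have "i div b < a" "j div b < a"
    using ij by (simp_all add: less_mult_imp_div_less)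
  moreover have "i = j \<longleftrightarrow> i div b = j div b \<and> i mod b = j mod b"
    by (metis div_mult_mod_eq)
  ultimately show "(1\<^sub>m a \<otimes>\<^sub>k 1\<^sub>m b) $$ (i, j) = (1\<^sub>m (a * b) :: complex mat) $$ (i, j)"
    using ij by (auto simp: kron_def)
qed simp_all

lemma unitary_mat_one: "unitary_mat N (1\<^sub>m N)"
proof -
  have "mat_adjoint (1\<^sub>m N) = (1\<^sub>m N :: complex mat)"
    by (rule eq_matI) (auto simp: index_mat_adjoint)
  then show ?thesis
    by (simp add: unitary_mat_def)
qed

lemma unitary_mat_kron:
  assumes "unitary_mat M A" "unitary_mat N B"
  shows "unitary_mat (M * N) (A \<otimes>\<^sub>k B)"
proof -
  have "(A \<otimes>\<^sub>k B) * mat_adjoint (A \<otimes>\<^sub>k B) = (A * mat_adjoint A) \<otimes>\<^sub>k (B * mat_adjoint B)"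
    unfolding mat_adjoint_kron by (rule kron_mult_kron) simp_all
  also have "\<dots> = 1\<^sub>m (M * N)"
    using assms by (simp only: unitary_mat_def kron_one)
  finally have "(A \<otimes>\<^sub>k B) * mat_adjoint (A \<otimes>\<^sub>k B) = 1\<^sub>m (M * N)" .
  moreover have "A \<otimes>\<^sub>k B \<in> carrier_mat (M * N) (M * N)"
    using assms unfolding unitary_mat_def by (intro carrier_matI) auto
  ultimately show ?thesis
    by (simp only: unitary_mat_def)
qed

lemma mat_adjoint_mult:
  fixes A B :: "complex mat"
  assumes "A \<in> carrier_mat N N" "B \<in> carrier_mat N N"
  shows "mat_adjoint (A * B) = mat_adjoint B * mat_adjoint A"
  by (rule eq_matI)
    (use carrier_matD[OF assms(1)] carrier_matD[OF assms(2)]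
      in \<open>simp_all add: index_mat_adjoint scalar_prod_def mult.commute\<close>)

lemma unitary_mat_mult:
  assumes "unitary_mat N A" "unitary_mat N B"
  shows "unitary_mat N (A * B)"
proof -
  have A: "A \<in> carrier_mat N N" "A * mat_adjoint A = 1\<^sub>m N"
    and B: "B \<in> carrier_mat N N" "B * mat_adjoint B = 1\<^sub>m N"
    using assms by (auto simp: unitary_mat_def)
  have A': "mat_adjoint A \<in> carrier_mat N N" and B': "mat_adjoint B \<in> carrier_mat N N"
    using A(1) B(1) by auto
  have "(A * B) * mat_adjoint (A * B) = (A * B) * (mat_adjoint B * mat_adjoint A)"
    using A(1) B(1) by (simp only: mat_adjoint_mult)
  also have "\<dots> = A * (B * (mat_adjoint B * mat_adjoint A))"
    by (rule assoc_mult_mat[OF A(1) B(1) mult_carrier_mat[OF B' A']])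
  also have "B * (mat_adjoint B * mat_adjoint A) = B * mat_adjoint B * mat_adjoint A"
    by (rule assoc_mult_mat[OF B(1) B' A', symmetric])
  also have "\<dots> = mat_adjoint A"
    using A' by (simp only: B(2) left_mult_one_mat)
  also have "A * mat_adjoint A = 1\<^sub>m N"
    by (rule A(2))
  finally show ?thesis
    using A(1) B(1) unfolding unitary_mat_def by (intro conjI mult_carrier_mat)
qed

lemma unitary_mat_matchgate:
  assumes "matchgate G"
  shows "unitary_mat 4 G"
proof -
  obtain a b c d u v x y where G: "G = mat_of_rows_list 4
      [[a, 0, 0, b], [0, u, v, 0], [0, x, y, 0], [c, 0, 0, d]]"
    and AB: "mat_of_rows_list 2 [[a, b], [c, d]] \<in> SU2" "mat_of_rows_list 2 [[u, v], [x, y]] \<in> SU2"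
    using assms unfolding matchgate_def by blast
  have *: "p * cnj p + q * cnj q = 1 \<and> p * cnj r + q * cnj s = 0 \<and>
      r * cnj p + s * cnj q = 0 \<and> r * cnj r + s * cnj s = 1"
    if "mat_of_rows_list 2 [[p, q], [r, s]] \<in> SU2" for p q r s
  proof -
    let ?A = "mat_of_rows_list 2 [[p, q], [r, s]]"
    have "?A * mat_adjoint ?A = 1\<^sub>m 2"
      using that by (simp add: SU2_def unitary_mat_def)
    then have "(?A * mat_adjoint ?A) $$ (i, j) = 1\<^sub>m 2 $$ (i, j)" for i j
      by simp
    from this[of 0 0] this[of 0 1] this[of 1 0] this[of 1 1] show ?thesis
      by (simp add: scalar_prod_def mat_of_rows_list_def index_mat_adjoint numeral_2_eq_2)
  qed
  have "G * mat_adjoint G = 1\<^sub>m 4"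
  proof (rule eq_matI)
    fix i j
    assume "i < dim_row (1\<^sub>m 4 :: complex mat)" "j < dim_col (1\<^sub>m 4 :: complex mat)"
    then have "i \<in> {0, 1, 2, 3}" "j \<in> {0, 1, 2, 3}"
      by auto
    then show "(G * mat_adjoint G) $$ (i, j) = 1\<^sub>m 4 $$ (i, j)"
      using *[OF AB(1)] *[OF AB(2)] unfolding G
      by (auto simp: scalar_prod_def mat_of_rows_list_def index_mat_adjoint
          eval_nat_numeral add.commute)
  qed (simp_all add: G mat_of_rows_list_def)
  moreover have "G \<in> carrier_mat 4 4"
    by (rule carrier_matI) (simp_all add: G mat_of_rows_list_def)
  ultimately show ?thesis
    by (simp add: unitary_mat_def)
qed

lemma unitary_mat_matchgate_circuit:
  assumes "matchgate_circuit m U"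
  shows "unitary_mat (2 ^ m) U"
  using assms
proof induction
  case empty
  show ?case by (rule unitary_mat_one)
next
  case (gate G k U)
  have "unitary_mat (2 ^ k * 4 * 2 ^ (m - k - 2)) (on_neighbours m k G)"
    unfolding on_neighbours_def
    by (intro unitary_mat_kron unitary_mat_one unitary_mat_matchgate gate)
  moreover have "(2::nat) ^ k * 4 * 2 ^ (m - k - 2) = 2 ^ m"
  proof -
    obtain r where "m = k + 2 + r"
      using gate.hyps by (metis Suc_eq_plus1 Suc_leI add_2_eq_Suc' le_Suc_ex)
    then show ?thesis
      by (simp add: power_add)
  qed
  ultimately show ?case
    using gate by (simp add: unitary_mat_mult)
qed

end

theory Submission
  imports Defs
begin

text \<open>
  Conjugation by a matchgate maps the real span of the Majorana operators isometrically to itself.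
  The observable measured on the first qubit is \<open>-i\<close> times a product of two such operators, so in
  the Heisenberg picture it remains \<open>-i\<close> times a product of two normalised elements of this span.
  Its expectation in the basis state \<open>|z>\<close> is therefore \<open>\<Sum>j. (-1)^z\<^sub>j h\<^sub>j\<close> with
  \<open>\<Sum>j. |h\<^sub>j| \<le> 1\<close> by Cauchy-Schwarz. Success probability above \<open>3/4\<close> forces \<open>|h\<^sub>k| > 1/2\<close> for every
  bit \<open>k\<close> on which \<open>f\<close> depends, so there is at most one such bit. Conversely, swap-like matchgates
  bring the relevant bit (or an ancilla, for constant \<open>f\<close>) to the front, and the matchgate flipping
  both of its qubits negates it.
\<close>

section \<open>Kronecker products\<close>

lemma kron_carrier:
  "A \<in> carrier_mat a b \<Longrightarrow> B \<in> carrier_mat c d \<Longrightarrow> A \<otimes>\<^sub>k B \<in> carrier_mat (a * c) (b * d)"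
  by (auto intro!: carrier_matI)

lemma kron_index:
  assumes "i < dim_row A * dim_row B" "j < dim_col A * dim_col B"
  shows "(A \<otimes>\<^sub>k B) $$ (i, j) =
    A $$ (i div dim_row B, j div dim_col B) * B $$ (i mod dim_row B, j mod dim_col B)"
  using assms by (simp add: kron_def)

text \<open>Both sides read off the same three mixed-radix digits of each index; only the order of
  the divisions differs.\<close>

lemma kron_assoc: "(A \<otimes>\<^sub>k B) \<otimes>\<^sub>k C = A \<otimes>\<^sub>k (B \<otimes>\<^sub>k C)"
proof (rule eq_matI)
  fix i j
  assume "i < dim_row (A \<otimes>\<^sub>k (B \<otimes>\<^sub>k C))" "j < dim_col (A \<otimes>\<^sub>k (B \<otimes>\<^sub>k C))"
  then have ij: "i < dim_row A * dim_row B * dim_row C" "j < dim_col A * dim_col B * dim_col C"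
    by (simp_all add: mult.assoc)
  then have pos: "0 < dim_row C" "0 < dim_col C" "0 < dim_row B" "0 < dim_col B"
    by (auto intro: gr0I)
  have d: "i div dim_row C < dim_row A * dim_row B" "j div dim_col C < dim_col A * dim_col B"
    using ij by (simp_all add: less_mult_imp_div_less)
  have m: "i mod (dim_row B * dim_row C) < dim_row B * dim_row C"
    "j mod (dim_col B * dim_col C) < dim_col B * dim_col C"
    using pos by simp_all
  show "((A \<otimes>\<^sub>k B) \<otimes>\<^sub>k C) $$ (i, j) = (A \<otimes>\<^sub>k (B \<otimes>\<^sub>k C)) $$ (i, j)"
    using ij d m pos
    by (simp add: kron_index mult.assoc[symmetric])
      (simp add: mult.commute[of "dim_row B"] mult.commute[of "dim_col B"] mod_mult2_eq div_mult2_eq)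
qed (simp_all add: mult.assoc)

lemma kron_add_left:
  assumes "A \<in> carrier_mat a b" "B \<in> carrier_mat a b"
  shows "(A + B) \<otimes>\<^sub>k C = A \<otimes>\<^sub>k C + B \<otimes>\<^sub>k C"
  by (rule eq_matI)
    (use assms in \<open>auto simp: kron_index less_mult_imp_div_less distrib_right\<close>)

lemma kron_add_right:
  assumes "A \<in> carrier_mat a b" "B \<in> carrier_mat a b"
  shows "C \<otimes>\<^sub>k (A + B) = C \<otimes>\<^sub>k A + C \<otimes>\<^sub>k B"
proof (rule eq_matI)
  fix i j
  assume "i < dim_row (C \<otimes>\<^sub>k A + C \<otimes>\<^sub>k B)" "j < dim_col (C \<otimes>\<^sub>k A + C \<otimes>\<^sub>k B)"
  then have ij: "i < dim_row C * a" "j < dim_col C * b"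
    using assms by auto
  then have "0 < a" "0 < b"
    by (auto intro: gr0I)
  then show "(C \<otimes>\<^sub>k (A + B)) $$ (i, j) = (C \<otimes>\<^sub>k A + C \<otimes>\<^sub>k B) $$ (i, j)"
    using ij assms by (auto simp: kron_index distrib_left)
qed (use assms in auto)

lemma kron_one_left: "1\<^sub>m 1 \<otimes>\<^sub>k A = A"
  by (rule eq_matI) (auto simp: kron_index)

lemma zero_kron: "0\<^sub>m a b \<otimes>\<^sub>k A = 0\<^sub>m (a * dim_row A) (b * dim_col A)"
  by (rule eq_matI) (auto simp: kron_index less_mult_imp_div_less)

lemma kron_zero: "A \<otimes>\<^sub>k 0\<^sub>m a b = 0\<^sub>m (dim_row A * a) (dim_col A * b)"
proof (rule eq_matI)
  fix i j
  assume "i < dim_row (0\<^sub>m (dim_row A * a) (dim_col A * b) :: complex mat)"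
    "j < dim_col (0\<^sub>m (dim_row A * a) (dim_col A * b) :: complex mat)"
  then have ij: "i < dim_row A * a" "j < dim_col A * b"
    by auto
  then have "0 < a" "0 < b"
    by (auto intro: gr0I)
  then show "(A \<otimes>\<^sub>k 0\<^sub>m a b) $$ (i, j) = 0\<^sub>m (dim_row A * a) (dim_col A * b) $$ (i, j)"
    using ij by (auto simp: kron_index)
qed auto

lemma kron_one_right: "A \<otimes>\<^sub>k 1\<^sub>m 1 = A"
  by (rule eq_matI) (auto simp: kron_index)

section \<open>Majorana operators and matchgates\<close>

definition mat22 :: "complex \<Rightarrow> complex \<Rightarrow> complex \<Rightarrow> complex \<Rightarrow> complex mat" where
  "mat22 a b c d = mat_of_rows_list 2 [[a, b], [c, d]]"

lemma mat22_carrier [simp]: "mat22 a b c d \<in> carrier_mat 2 2"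
  by (rule carrier_matI) (simp_all add: mat22_def mat_of_rows_list_def)

lemma mat22_dims [simp]: "dim_row (mat22 a b c d) = 2" "dim_col (mat22 a b c d) = 2"
  using carrier_matD[OF mat22_carrier] by auto

lemma mat22_index [simp]:
  "mat22 a b c d $$ (0, 0) = a" "mat22 a b c d $$ (0, 1) = b"
  "mat22 a b c d $$ (1, 0) = c" "mat22 a b c d $$ (1, 1) = d"
  "mat22 a b c d $$ (0, Suc 0) = b"
  "mat22 a b c d $$ (Suc 0, 0) = c" "mat22 a b c d $$ (Suc 0, Suc 0) = d"
  by (simp_all add: mat22_def mat_of_rows_list_def)

lemma mat22_mult:
  "mat22 a b c d * mat22 a' b' c' d' =
    mat22 (a * a' + b * c') (a * b' + b * d') (c * a' + d * c') (c * b' + d * d')"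
proof (rule eq_matI)
  fix i j
  assume "i < dim_row (mat22 (a * a' + b * c') (a * b' + b * d') (c * a' + d * c') (c * b' + d * d'))"
    "j < dim_col (mat22 (a * a' + b * c') (a * b' + b * d') (c * a' + d * c') (c * b' + d * d'))"
  then have "i \<in> {0, 1}" "j \<in> {0, 1}"
    by auto
  then show "(mat22 a b c d * mat22 a' b' c' d') $$ (i, j) =
    mat22 (a * a' + b * c') (a * b' + b * d') (c * a' + d * c') (c * b' + d * d') $$ (i, j)"
    by (auto simp: scalar_prod_def numeral_2_eq_2)
qed auto

abbreviation pauli_Z :: "complex mat" where
  "pauli_Z \<equiv> mat22 1 0 0 (-1)"

abbreviation mode :: "complex \<Rightarrow> complex mat" where
  "mode w \<equiv> mat22 0 w (cnj w) 0"

text \<open>The Jordan-Wigner string, which makes Majorana operators on different qubits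
  anticommute.\<close>

fun parity_mat :: "nat \<Rightarrow> complex mat" where
  "parity_mat 0 = 1\<^sub>m 1"
| "parity_mat (Suc n) = pauli_Z \<otimes>\<^sub>k parity_mat n"

text \<open>
  One complex coefficient \<open>w = r - i s\<close> per qubit encodes the two real coefficients \<open>r\<close>, \<open>s\<close> of the
  Majorana operators \<open>Z \<dots> Z X\<close> and \<open>Z \<dots> Z Y\<close> of this qubit, since \<open>r X + s Y = mode w\<close>.
\<close>

fun majorana :: "complex list \<Rightarrow> complex mat" where
  "majorana [] = 0\<^sub>m 1 1"
| "majorana (w # ws) = mode w \<otimes>\<^sub>k 1\<^sub>m (2 ^ length ws) + pauli_Z \<otimes>\<^sub>k majorana ws"

lemma parity_mat_carrier [simp]: "parity_mat n \<in> carrier_mat (2 ^ n) (2 ^ n)"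
  by (induction n) (simp_all add: kron_carrier)

lemma parity_mat_dims [simp]: "dim_row (parity_mat n) = 2 ^ n" "dim_col (parity_mat n) = 2 ^ n"
  using carrier_matD[OF parity_mat_carrier] by auto

lemma majorana_carrier [simp]: "majorana ws \<in> carrier_mat (2 ^ length ws) (2 ^ length ws)"
  by (induction ws) (auto intro!: kron_carrier add_carrier_mat)

lemma majorana_dims [simp]:
  "dim_row (majorana ws) = 2 ^ length ws" "dim_col (majorana ws) = 2 ^ length ws"
  using carrier_matD[OF majorana_carrier] by auto

text \<open>Every operator of the second block carries the full string of \<open>Z\<close> over the
  first block. Applied twice, this isolates the two qubits on which a gate acts.\<close>

lemma majorana_append:
  "majorana (us @ ws) =
    majorana us \<otimes>\<^sub>k 1\<^sub>m (2 ^ length ws) + parity_mat (length us) \<otimes>\<^sub>k majorana ws"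
proof (induction us)
  case Nil
  have "0\<^sub>m (2 ^ length ws) (2 ^ length ws) + majorana ws = majorana ws"
    by (rule left_add_zero_mat) simp
  then show ?case
    by (simp add: zero_kron kron_one_left[simplified])
next
  case (Cons u us)
  let ?k = "length us" and ?r = "length ws"
  have 1: "mode u \<otimes>\<^sub>k 1\<^sub>m (2 ^ (?k + ?r)) = (mode u \<otimes>\<^sub>k 1\<^sub>m (2 ^ ?k)) \<otimes>\<^sub>k 1\<^sub>m (2 ^ ?r)"
    by (simp add: kron_assoc kron_one power_add)
  have 2: "pauli_Z \<otimes>\<^sub>k majorana (us @ ws) =
      (pauli_Z \<otimes>\<^sub>k majorana us) \<otimes>\<^sub>k 1\<^sub>m (2 ^ ?r) +
      (pauli_Z \<otimes>\<^sub>k parity_mat ?k) \<otimes>\<^sub>k majorana ws"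
    unfolding Cons.IH kron_assoc
    by (rule kron_add_right[where a = "2 ^ ?k * 2 ^ ?r" and b = "2 ^ ?k * 2 ^ ?r"])
      (simp_all add: kron_carrier)
  have 3: "(mode u \<otimes>\<^sub>k 1\<^sub>m (2 ^ ?k) + pauli_Z \<otimes>\<^sub>k majorana us) \<otimes>\<^sub>k 1\<^sub>m (2 ^ ?r) =
      (mode u \<otimes>\<^sub>k 1\<^sub>m (2 ^ ?k)) \<otimes>\<^sub>k 1\<^sub>m (2 ^ ?r) + (pauli_Z \<otimes>\<^sub>k majorana us) \<otimes>\<^sub>k 1\<^sub>m (2 ^ ?r)"
    by (rule kron_add_left[where a = "2 * 2 ^ ?k" and b = "2 * 2 ^ ?k"]) (auto intro!: kron_carrier)
  show ?case
    by (simp add: 1 2 3)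
      (rule assoc_add_mat[symmetric, where nr = "2 * 2 ^ ?k * 2 ^ ?r" and nc = "2 * 2 ^ ?k * 2 ^ ?r"];
       intro kron_carrier mat22_carrier one_carrier_mat majorana_carrier parity_mat_carrier)
qed

section \<open>Two adjacent qubits: explicit matrices and conjugation by one matchgate\<close>

definition pair_mode :: "complex \<Rightarrow> complex \<Rightarrow> complex mat" where
  "pair_mode w w' = mat_of_rows_list 4
     [[0, w', w, 0],
      [cnj w', 0, 0, w],
      [cnj w, 0, 0, - w'],
      [0, cnj w, - cnj w', 0]]"

lemma majorana_single: "majorana [w] = mode w"
  by (simp add: kron_one_right[simplified] kron_zero)

text \<open>With the entries written out, conjugation by a gate becomes a finite list of scalar
  identities.\<close>

lemma majorana_pair: "majorana [w, w'] = pair_mode w w'"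
proof -
  have "majorana [w, w'] = mode w \<otimes>\<^sub>k 1\<^sub>m 2 + pauli_Z \<otimes>\<^sub>k mode w'"
    unfolding majorana.simps(2)[of w] majorana_single by simp
  also have "\<dots> = pair_mode w w'"
  proof (rule eq_matI)
    fix i j
    assume "i < dim_row (pair_mode w w')" "j < dim_col (pair_mode w w')"
    then have "i \<in> {0, 1, 2, 3}" "j \<in> {0, 1, 2, 3}"
      by (auto simp: pair_mode_def mat_of_rows_list_def)
    then show "(mode w \<otimes>\<^sub>k 1\<^sub>m 2 + pauli_Z \<otimes>\<^sub>k mode w') $$ (i, j) = pair_mode w w' $$ (i, j)"
      by (auto simp: kron_index pair_mode_def mat_of_rows_list_def)
  qed (auto simp: pair_mode_def mat_of_rows_list_def)
  finally show ?thesis .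
qed

lemma parity_pair: "parity_mat 2 = mat_of_rows_list 4
     [[1, 0, 0, 0], [0, -1, 0, 0], [0, 0, -1, 0], [0, 0, 0, 1]]" (is "_ = ?M")
proof -
  have "parity_mat 2 = pauli_Z \<otimes>\<^sub>k pauli_Z"
    by (simp add: numeral_2_eq_2 kron_one_right[simplified])
  also have "\<dots> = ?M"
  proof (rule eq_matI)
    fix i j
    assume "i < dim_row ?M" "j < dim_col ?M"
    then have "i \<in> {0, 1, 2, 3}" "j \<in> {0, 1, 2, 3}"
      by (auto simp: mat_of_rows_list_def)
    then show "(pauli_Z \<otimes>\<^sub>k pauli_Z) $$ (i, j) = ?M $$ (i, j)"
      by (auto simp: kron_index mat_of_rows_list_def)
  qed (auto simp: mat_of_rows_list_def)
  finally show ?thesis .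
qed

text \<open>Membership in SU(2) fixes the second row of each block, so the two first rows
  parametrise all matchgates.\<close>

definition matchgate_of :: "complex \<Rightarrow> complex \<Rightarrow> complex \<Rightarrow> complex \<Rightarrow> complex mat" where
  "matchgate_of a b u v = mat_of_rows_list 4
     [[a, 0, 0, b],
      [0, u, v, 0],
      [0, - cnj v, cnj u, 0],
      [- cnj b, 0, 0, cnj a]]"

lemma SU2_iff:
  "mat22 a b c d \<in> SU2 \<longleftrightarrow> a * cnj a + b * cnj b = 1 \<and> c = - cnj b \<and> d = cnj a"
proof -
  have adj: "mat_adjoint (mat22 a b c d) = mat22 (cnj a) (cnj c) (cnj b) (cnj d)"
  proof (rule eq_matI)
    fix i j
    assume "i < dim_row (mat22 (cnj a) (cnj c) (cnj b) (cnj d))"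
      "j < dim_col (mat22 (cnj a) (cnj c) (cnj b) (cnj d))"
    then have "i \<in> {0, 1}" "j \<in> {0, 1}"
      by auto
    then show "mat_adjoint (mat22 a b c d) $$ (i, j) = mat22 (cnj a) (cnj c) (cnj b) (cnj d) $$ (i, j)"
      by (auto simp: index_mat_adjoint)
  qed auto
  have one: "1\<^sub>m 2 = mat22 1 0 0 1"
    by (rule eq_matI) (auto simp: numeral_2_eq_2 less_Suc_eq)
  have inj: "mat22 p q r s = mat22 p' q' r' s' \<longleftrightarrow> p = p' \<and> q = q' \<and> r = r' \<and> s = s'"
    for p q r s p' q' r' s'
    by (metis mat22_index(1-4))
  have det: "det (mat22 a b c d) = a * d - b * c"
    by (subst laplace_expansion_row[of _ 2 0])
      (auto simp: cofactor_def mat_delete_def det_single numeral_2_eq_2)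
  have iff: "mat22 a b c d \<in> SU2 \<longleftrightarrow> a * cnj a + b * cnj b = 1 \<and> a * cnj c + b * cnj d = 0 \<and>
      c * cnj a + d * cnj b = 0 \<and> c * cnj c + d * cnj d = 1 \<and> a * d - b * c = 1"
    by (auto simp: SU2_def unitary_mat_def adj mat22_mult one inj det)
  show ?thesis
  proof
    assume "mat22 a b c d \<in> SU2"
    then have 1: "a * cnj a + b * cnj b = 1" and 2: "c * cnj a + d * cnj b = 0"
      and 3: "a * d - b * c = 1"
      by (auto simp: iff)
    \<comment> \<open>Multiplying by the squared norm of the first row and regrouping expresses
      \<open>d\<close>, and then \<open>c\<close>, through the determinant and the orthogonality
      relation.\<close>
    have "d = (a * cnj a + b * cnj b) * d"
      by (simp add: 1)
    also have "\<dots> = cnj a * (a * d - b * c) + b * (c * cnj a + d * cnj b)"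
      by (simp add: algebra_simps)
    finally have "d = cnj a"
      by (simp add: 2 3)
    moreover have "c = (a * cnj a + b * cnj b) * c"
      by (simp add: 1)
    then have "c = a * (c * cnj a + d * cnj b) - cnj b * (a * d - b * c)"
      by (simp add: algebra_simps)
    then have "c = - cnj b"
      by (simp add: 2 3)
    ultimately show "a * cnj a + b * cnj b = 1 \<and> c = - cnj b \<and> d = cnj a"
      using 1 by simp
  qed (unfold iff, auto simp: mult.commute add.commute)
qed

lemma matchgate_iff:
  "matchgate G \<longleftrightarrow> (\<exists>a b u v. G = matchgate_of a b u v \<and>
     a * cnj a + b * cnj b = 1 \<and> u * cnj u + v * cnj v = 1)"
  unfolding matchgate_def mat22_def[symmetric] SU2_iff matchgate_of_def by blast

text \<open>
  With respect to the decomposition into \<open>|00>, |11>\<close> and \<open>|01>, |10>\<close>, \<open>pair_mode w w'\<close> has the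
  off-diagonal block \<open>B = [[w', w], [cnj w, - cnj w']]\<close>, and conjugation by a matchgate with blocks
  \<open>A\<close> and \<open>D\<close> replaces \<open>B\<close> by the adjoint of \<open>A\<close> times \<open>B D\<close>; the new coefficients are the entries
  of its first row.
\<close>

definition image_left :: "complex \<Rightarrow> complex \<Rightarrow> complex \<Rightarrow> complex \<Rightarrow> complex \<Rightarrow> complex \<Rightarrow> complex" where
  "image_left a b u v w w' =
     cnj a * (w' * v + w * cnj u) - b * (cnj w * v - cnj w' * cnj u)"

definition image_right :: "complex \<Rightarrow> complex \<Rightarrow> complex \<Rightarrow> complex \<Rightarrow> complex \<Rightarrow> complex \<Rightarrow> complex" where
  "image_right a b u v w w' =
     cnj a * (w' * u - w * cnj v) - b * (cnj w * u + cnj w' * cnj v)"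

text \<open>The off-diagonal block \<open>B\<close> is a scalar times a unitary matrix, and
  multiplying it by unitary blocks on both sides preserves the norm of its first row. This is the
  isometry on the real span of the Majorana operators.\<close>

lemma image_norm:
  assumes "a * cnj a + b * cnj b = 1" "u * cnj u + v * cnj v = 1"
  shows "(cmod (image_left a b u v w w'))\<^sup>2 + (cmod (image_right a b u v w w'))\<^sup>2 =
    (cmod w)\<^sup>2 + (cmod w')\<^sup>2"
proof -
  let ?l = "image_left a b u v w w'" and ?r = "image_right a b u v w w'"
  have "?l * cnj ?l + ?r * cnj ?r =
    (a * cnj a + b * cnj b) * (u * cnj u + v * cnj v) * (w * cnj w + w' * cnj w')"
    unfolding image_left_def image_right_def by (simp add: algebra_simps)
  then have "of_real ((cmod ?l)\<^sup>2 + (cmod ?r)\<^sup>2) = (of_real ((cmod w)\<^sup>2 + (cmod w')\<^sup>2) :: complex)"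
    unfolding of_real_add complex_norm_square by (simp add: assms)
  then show ?thesis
    by (simp only: of_real_eq_iff)
qed

text \<open>Both blocks have determinant 1, so the transformed \<open>B\<close> keeps its
  determinant and its second row is still determined by its first; the result is again a
  \<open>pair_mode\<close>. The intertwining form avoids inverses.\<close>

lemma pair_mode_matchgate:
  assumes "a * cnj a + b * cnj b = 1" "u * cnj u + v * cnj v = 1"
  shows "pair_mode w w' * matchgate_of a b u v =
    matchgate_of a b u v * pair_mode (image_left a b u v w w') (image_right a b u v w w')"
    (is "?L = ?R")
proof (rule eq_matI)
  \<comment> \<open>Each entry on the right that is not trivially zero equals the left entry times
    the squared row norm of one block; \<open>A\<close> and \<open>U\<close> insert this factor
    1.\<close>
  have A: "p = q" if "q = (a * cnj a + b * cnj b) * p" for p q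
    using that by (simp add: assms)
  have U: "p = q" if "q = (u * cnj u + v * cnj v) * p" for p q
    using that by (simp add: assms)
  fix i j
  assume "i < dim_row ?R" "j < dim_col ?R"
  then have "i \<in> {0, 1, 2, 3}" "j \<in> {0, 1, 2, 3}"
    by (auto simp: matchgate_of_def pair_mode_def mat_of_rows_list_def)
  then show "?L $$ (i, j) = ?R $$ (i, j)"
    by (elim insertE emptyE,
        simp_all add: scalar_prod_def pair_mode_def matchgate_of_def mat_of_rows_list_def
          numeral_eq_Suc image_left_def image_right_def)
      ((rule A; simp add: algebra_simps; fail) | (rule U; simp add: algebra_simps; fail))+
qed (auto simp: matchgate_of_def pair_mode_def mat_of_rows_list_def)

text \<open>A matchgate does not mix \<open>|00>, |11>\<close> with \<open>|01>, |10>\<close>. Hence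
  it passes through the strings of \<open>Z\<close> belonging to later qubits.\<close>

lemma parity_pair_matchgate:
  "parity_mat 2 * matchgate_of a b u v = matchgate_of a b u v * parity_mat 2" (is "?L = ?R")
proof (rule eq_matI)
  fix i j
  assume "i < dim_row ?R" "j < dim_col ?R"
  then have "i \<in> {0, 1, 2, 3}" "j \<in> {0, 1, 2, 3}"
    by (auto simp: matchgate_of_def mat_of_rows_list_def)
  then show "?L $$ (i, j) = ?R $$ (i, j)"
    unfolding parity_pair
    by (elim insertE emptyE)
      (simp_all add: scalar_prod_def matchgate_of_def mat_of_rows_list_def numeral_eq_Suc)
qed (auto simp: matchgate_of_def mat_of_rows_list_def)

section \<open>Gates and circuits inside a longer register\<close>

lemma matchgate_of_carrier: "matchgate_of a b u v \<in> carrier_mat 4 4"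
  by (rule carrier_matI) (simp_all add: matchgate_of_def mat_of_rows_list_def)

lemma pair_mode_carrier: "pair_mode w w' \<in> carrier_mat 4 4"
  by (rule carrier_matI) (simp_all add: pair_mode_def mat_of_rows_list_def)

lemma parity_pair_carrier: "parity_mat 2 \<in> carrier_mat 4 4"
  using parity_mat_carrier[of 2] by simp

lemma kron3_mult:
  assumes "A \<in> carrier_mat k k" "A' \<in> carrier_mat k k"
    and "B \<in> carrier_mat l l" "B' \<in> carrier_mat l l"
    and "C \<in> carrier_mat r r" "C' \<in> carrier_mat r r"
  shows "(A \<otimes>\<^sub>k (B \<otimes>\<^sub>k C)) * (A' \<otimes>\<^sub>k (B' \<otimes>\<^sub>k C')) = (A * A') \<otimes>\<^sub>k ((B * B') \<otimes>\<^sub>k (C * C'))"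
proof -
  have "(A \<otimes>\<^sub>k (B \<otimes>\<^sub>k C)) * (A' \<otimes>\<^sub>k (B' \<otimes>\<^sub>k C')) =
      (A * A') \<otimes>\<^sub>k ((B \<otimes>\<^sub>k C) * (B' \<otimes>\<^sub>k C'))"
    using assms by (intro kron_mult_kron) auto
  also have "(B \<otimes>\<^sub>k C) * (B' \<otimes>\<^sub>k C') = (B * B') \<otimes>\<^sub>k (C * C')"
    using assms by (intro kron_mult_kron) auto
  finally show ?thesis .
qed

text \<open>The three summands belong to the qubits before, at and after the gate; all are bracketed
  like the gate itself, so that products can be taken factor by factor.\<close>

lemma majorana_split:
  "majorana (us @ [w, w'] @ ws) =
    majorana us \<otimes>\<^sub>k (1\<^sub>m 4 \<otimes>\<^sub>k 1\<^sub>m (2 ^ length ws)) +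
    (parity_mat (length us) \<otimes>\<^sub>k (pair_mode w w' \<otimes>\<^sub>k 1\<^sub>m (2 ^ length ws)) +
     parity_mat (length us) \<otimes>\<^sub>k (parity_mat 2 \<otimes>\<^sub>k majorana ws))"
proof -
  have 1: "majorana ([w, w'] @ ws) =
      pair_mode w w' \<otimes>\<^sub>k 1\<^sub>m (2 ^ length ws) + parity_mat 2 \<otimes>\<^sub>k majorana ws"
    unfolding majorana_append[of "[w, w']"] majorana_pair by (simp add: numeral_2_eq_2)
  have 2: "parity_mat (length us) \<otimes>\<^sub>k
      (pair_mode w w' \<otimes>\<^sub>k 1\<^sub>m (2 ^ length ws) + parity_mat 2 \<otimes>\<^sub>k majorana ws) =
     parity_mat (length us) \<otimes>\<^sub>k (pair_mode w w' \<otimes>\<^sub>k 1\<^sub>m (2 ^ length ws)) +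
     parity_mat (length us) \<otimes>\<^sub>k (parity_mat 2 \<otimes>\<^sub>k majorana ws)"
    by (rule kron_add_right[where a = "4 * 2 ^ length ws" and b = "4 * 2 ^ length ws"]; intro kron_carrier pair_mode_carrier parity_pair_carrier
        one_carrier_mat majorana_carrier)
  show ?thesis
    unfolding majorana_append[of us] 1 2 kron_one by simp
qed

text \<open>Only the middle summand changes: the first one is the identity on the qubits of the
  gate, and the last one meets the gate only in \<open>parity_mat 2\<close>, which commutes with
  it.\<close>

lemma majorana_on_neighbours:
  assumes ab: "a * cnj a + b * cnj b = 1" and uv: "u * cnj u + v * cnj v = 1"
    and m: "m = length us + 2 + length ws"
  shows "majorana (us @ [w, w'] @ ws) * on_neighbours m (length us) (matchgate_of a b u v) =
    on_neighbours m (length us) (matchgate_of a b u v) *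
      majorana (us @ [image_left a b u v w w', image_right a b u v w w'] @ ws)"
proof -
  let ?k = "2 ^ length us :: nat" and ?r = "2 ^ length ws :: nat"
  let ?G = "matchgate_of a b u v"
  let ?l = "image_left a b u v w w'" and ?s = "image_right a b u v w w'"
  define N where "N = 1\<^sub>m ?k \<otimes>\<^sub>k (?G \<otimes>\<^sub>k 1\<^sub>m ?r)"
  have N: "on_neighbours m (length us) ?G = N"
    by (simp add: on_neighbours_def N_def kron_assoc m)
  define T1 where "T1 = majorana us \<otimes>\<^sub>k (1\<^sub>m 4 \<otimes>\<^sub>k 1\<^sub>m ?r)"
  define T2 where "T2 x y = parity_mat (length us) \<otimes>\<^sub>k (pair_mode x y \<otimes>\<^sub>k 1\<^sub>m ?r)" for x y
  define T3 where "T3 = parity_mat (length us) \<otimes>\<^sub>k (parity_mat 2 \<otimes>\<^sub>k majorana ws)"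
  note carriers = majorana_carrier parity_mat_carrier parity_pair_carrier pair_mode_carrier
    matchgate_of_carrier one_carrier_mat
  have c: "T1 \<in> carrier_mat (?k * (4 * ?r)) (?k * (4 * ?r))"
      "T3 \<in> carrier_mat (?k * (4 * ?r)) (?k * (4 * ?r))"
      "N \<in> carrier_mat (?k * (4 * ?r)) (?k * (4 * ?r))"
    unfolding T1_def T3_def N_def by (intro kron_carrier carriers)+
  have c2: "T2 x y \<in> carrier_mat (?k * (4 * ?r)) (?k * (4 * ?r))" for x y
    unfolding T2_def by (intro kron_carrier carriers)
  note mult = kron3_mult[where k = ?k and l = 4 and r = ?r, OF _ _ _ _ _ _]
  note one = left_mult_one_mat[where nr = ?k and nc = ?k] right_mult_one_mat[where nr = ?k and nc = ?k]
    left_mult_one_mat[where nr = 4 and nc = 4] right_mult_one_mat[where nr = 4 and nc = 4]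
    left_mult_one_mat[where nr = ?r and nc = ?r] right_mult_one_mat[where nr = ?r and nc = ?r]
  have 1: "T1 * N = N * T1"
    unfolding T1_def N_def
    by (subst mult; (intro carriers)?; subst mult; (intro carriers)?; simp add: one carriers)
  have 2: "T2 w w' * N = N * T2 ?l ?s"
    unfolding T2_def N_def
    by (subst mult; (intro carriers)?; subst mult; (intro carriers)?;
        simp add: one carriers pair_mode_matchgate[OF ab uv])
  have 3: "T3 * N = N * T3"
    unfolding T3_def N_def
    by (subst mult; (intro carriers)?; subst mult; (intro carriers)?;
        simp add: one carriers parity_pair_matchgate)
  have M: "majorana (us @ [x, y] @ ws) = T1 + (T2 x y + T3)" for x y
    unfolding T1_def T2_def T3_def by (rule majorana_split)
  show ?thesis
    unfolding N M
    by (simp add: 1 2 3 add_mult_distrib_mat[OF c(1) add_carrier_mat[OF c(2)] c(3)]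
        add_mult_distrib_mat[OF c2 c(2) c(3)]
        mult_add_distrib_mat[OF c(3) c(1) add_carrier_mat[OF c(2)]]
        mult_add_distrib_mat[OF c(3) c2 c(2)])
qed

lemma matchgate_circuit_carrier:
  "matchgate_circuit m U \<Longrightarrow> U \<in> carrier_mat (2 ^ m) (2 ^ m)"
  using unitary_mat_matchgate_circuit unitary_mat_def by blast

lemma on_neighbours_carrier:
  assumes "matchgate G" "k + 1 < m"
  shows "on_neighbours m k G \<in> carrier_mat (2 ^ m) (2 ^ m)"
proof -
  have "G \<in> carrier_mat 4 4"
    using assms(1) unitary_mat_matchgate unitary_mat_def by blast
  moreover have "2 ^ k * 4 * 2 ^ (m - k - 2) = (2 ^ m :: nat)"
  proof -
    obtain r where "m = k + 2 + r"
      using assms(2) by (metis Suc_eq_plus1 Suc_leI add_2_eq_Suc' le_Suc_ex)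
    then show ?thesis
      by (simp add: power_add)
  qed
  ultimately show ?thesis
    unfolding on_neighbours_def by (metis kron_carrier one_carrier_mat)
qed

text \<open>The gate applied last stands on the left, so in the Heisenberg picture it transforms the
  coefficients first and \<open>U\<close> acts on the outcome.\<close>

lemma majorana_gate_circuit:
  assumes "matchgate_circuit m U" "length ws = m"
    and ab: "a * cnj a + b * cnj b = 1" and uv: "u * cnj u + v * cnj v = 1"
    and m: "m = length us + 2 + length rs"
    and U: "majorana (us @ [image_left a b u v w w', image_right a b u v w w'] @ rs) * U =
      U * majorana ws"
  shows "majorana (us @ [w, w'] @ rs) * (on_neighbours m (length us) (matchgate_of a b u v) * U) =
    (on_neighbours m (length us) (matchgate_of a b u v) * U) * majorana ws"
proof -
  let ?N = "on_neighbours m (length us) (matchgate_of a b u v)"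
  have "matchgate (matchgate_of a b u v)"
    using ab uv matchgate_iff by blast
  moreover have "length us + 1 < m"
    by (simp add: m)
  ultimately have N: "?N \<in> carrier_mat (2 ^ m) (2 ^ m)"
    by (rule on_neighbours_carrier)
  have c: "U \<in> carrier_mat (2 ^ m) (2 ^ m)" "majorana ws \<in> carrier_mat (2 ^ m) (2 ^ m)"
    using matchgate_circuit_carrier[OF assms(1)] majorana_carrier[of ws] assms(2) by simp_all
  have M: "majorana (us @ [x, y] @ rs) \<in> carrier_mat (2 ^ m) (2 ^ m)" for x y
    using majorana_carrier[of "us @ [x, y] @ rs"] m by simp
  have "majorana (us @ [w, w'] @ rs) * (?N * U) = (majorana (us @ [w, w'] @ rs) * ?N) * U"
    by (rule assoc_mult_mat[OF M N c(1), symmetric])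
  also have "\<dots> = ?N * (majorana (us @ [image_left a b u v w w', image_right a b u v w w'] @ rs) * U)"
    unfolding majorana_on_neighbours[OF ab uv m] by (rule assoc_mult_mat[OF N M c(1)])
  also have "\<dots> = ?N * U * majorana ws"
    unfolding U by (rule assoc_mult_mat[OF N c, symmetric])
  finally show ?thesis .
qed

text \<open>Induction over the gates, for all coefficient lists at once, because the outermost gate
  changes the list before the induction hypothesis is used.\<close>

lemma majorana_circuit:
  assumes "matchgate_circuit m U" "length ws = m"
  shows "\<exists>ws'. length ws' = m \<and> (\<Sum>j<m. (cmod (ws' ! j))\<^sup>2) = (\<Sum>j<m. (cmod (ws ! j))\<^sup>2) \<and>
    majorana ws * U = U * majorana ws'"
  using assms
proof (induction arbitrary: ws)
  case empty
  then have "majorana ws \<in> carrier_mat (2 ^ m) (2 ^ m)"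
    using majorana_carrier by blast
  then show ?case
    using empty by (intro exI[of _ ws]) simp
next
  case (gate G k U)
  obtain a b u v where G: "G = matchgate_of a b u v"
    and ab: "a * cnj a + b * cnj b = 1" and uv: "u * cnj u + v * cnj v = 1"
    using gate.hyps(1) unfolding matchgate_iff by blast
  let ?us = "take k ws" and ?rs = "drop (k + 2) ws" and ?w = "ws ! k" and ?w' = "ws ! (k + 1)"
  let ?l = "image_left a b u v ?w ?w'" and ?s = "image_right a b u v ?w ?w'"
  let ?N = "on_neighbours m k G"
  define vs where "vs = ws[k := ?l, k + 1 := ?s]"
  have len: "length ?us = k" "m = length ?us + 2 + length ?rs" "length vs = m"
    using gate.hyps(2) gate.prems by (simp_all add: vs_def)
  have ws: "ws = ?us @ [?w, ?w'] @ ?rs"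
    using gate.hyps(2) gate.prems by (simp add: Cons_nth_drop_Suc)
  have "vs = (?us @ [?w, ?w'] @ ?rs)[k := ?l, k + 1 := ?s]"
    unfolding vs_def using ws by simp
  also have "\<dots> = ?us @ [?l, ?s] @ ?rs"
    using len(1) by (simp add: list_update_append)
  finally have vs: "vs = ?us @ [?l, ?s] @ ?rs" .
  have sums: "(\<Sum>j<m. (cmod (xs ! j))\<^sup>2) = (cmod (xs ! k))\<^sup>2 + (cmod (xs ! (k + 1)))\<^sup>2 +
      (\<Sum>j\<in>{..<m} - {k, k + 1}. (cmod (xs ! j))\<^sup>2)" for xs :: "complex list"
    using gate.hyps(2) by (subst sum.subset_diff[of "{k, k + 1}"]) auto
  have norm: "(\<Sum>j<m. (cmod (vs ! j))\<^sup>2) = (\<Sum>j<m. (cmod (ws ! j))\<^sup>2)"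
    unfolding sums using gate.hyps(2) gate.prems image_norm[OF ab uv, of ?w ?w']
    by (auto simp: vs_def intro!: sum.cong)
  obtain ws' where ws': "length ws' = m"
    "(\<Sum>j<m. (cmod (ws' ! j))\<^sup>2) = (\<Sum>j<m. (cmod (vs ! j))\<^sup>2)"
    "majorana vs * U = U * majorana ws'"
    using gate.IH[OF len(3)] by blast
  have "majorana ws * (?N * U) = ?N * U * majorana ws'"
    using majorana_gate_circuit[OF gate.hyps(3) ws'(1) ab uv len(2), of ?w ?w'] ws'(3) len(1) G ws vs
    by metis
  then show ?case
    using ws' norm by metis
qed

section \<open>Diagonal entries of a product of two Majorana combinations\<close>

lemma basis_index_less: "basis_index zs < 2 ^ length zs"
  by (induction zs) auto

text \<open>A product of operators of two different qubits flips bits and has no diagonal. On one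
  qubit the strings cancel and \<open>mode w * mode v\<close> is diagonal with entries
  \<open>w * cnj v\<close> and \<open>cnj w * v\<close>.\<close>

lemma majorana_mult_diag:
  assumes "length ws = length zs" "length vs = length zs"
  shows "(majorana ws * majorana vs) $$ (basis_index zs, basis_index zs) =
    (\<Sum>j<length zs. if zs ! j then cnj (ws ! j) * vs ! j else ws ! j * cnj (vs ! j))"
  using assms
proof (induction zs arbitrary: ws vs)
  case Nil
  then show ?case
    by (simp add: scalar_prod_def)
next
  case (Cons z zs)
  obtain w ws' v vs' where ws: "ws = w # ws'" "vs = v # vs'"
    and len: "length ws' = length zs" "length vs' = length zs"
    using Cons.prems by (auto simp: length_Suc_conv)
  define N :: nat where "N = 2 ^ length zs"
  define i where "i = basis_index zs"
  let ?M = "majorana ws'" and ?M' = "majorana vs'" and ?k = "of_bool z * N + i :: nat"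
  have i: "i < N"
    unfolding i_def N_def by (rule basis_index_less)
  have M: "?M \<in> carrier_mat N N" "?M' \<in> carrier_mat N N"
    unfolding N_def by (metis majorana_carrier len)+
  have X: "mode w \<otimes>\<^sub>k 1\<^sub>m N \<in> carrier_mat (2 * N) (2 * N)" for w
    by (intro kron_carrier) auto
  have Y: "pauli_Z \<otimes>\<^sub>k A \<in> carrier_mat (2 * N) (2 * N)" if "A \<in> carrier_mat N N" for A
    using that by (intro kron_carrier) auto
  have ind: "(A \<otimes>\<^sub>k B) $$ (?k, ?k) = A $$ (of_bool z, of_bool z) * B $$ (i, i)"
    if "A \<in> carrier_mat 2 2" "B \<in> carrier_mat N N" for A B
    using that i by (subst kron_index) auto
  have k: "?k < 2 * N"
    using i by auto
  have *: "(A * C) \<in> carrier_mat 2 2 \<and> (B * D) \<in> carrier_mat N N \<and>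
    (A \<otimes>\<^sub>k B) * (C \<otimes>\<^sub>k D) = (A * C) \<otimes>\<^sub>k (B * D)"
    if "A \<in> carrier_mat 2 2" "B \<in> carrier_mat N N" "C \<in> carrier_mat 2 2" "D \<in> carrier_mat N N"
    for A B C D
    using that by (auto intro!: kron_mult_kron)
  have prod: "((A \<otimes>\<^sub>k B) * (C \<otimes>\<^sub>k D)) $$ (?k, ?k) =
      (A * C) $$ (of_bool z, of_bool z) * (B * D) $$ (i, i)"
    if "A \<in> carrier_mat 2 2" "B \<in> carrier_mat N N" "C \<in> carrier_mat 2 2" "D \<in> carrier_mat N N"
    for A B C D
    using *[OF that] ind by simp
  have distr: "(A + B) * (C + D) = (A * C + A * D) + (B * C + B * D)"
    if "A \<in> carrier_mat (2 * N) (2 * N)" "B \<in> carrier_mat (2 * N) (2 * N)"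
      "C \<in> carrier_mat (2 * N) (2 * N)" "D \<in> carrier_mat (2 * N) (2 * N)"
    for A B C D :: "complex mat"
    using that add_mult_distrib_mat[OF that(1,2) add_carrier_mat[OF that(4)]]
      mult_add_distrib_mat[OF that(1,3,4)] mult_add_distrib_mat[OF that(2,3,4)]
    by simp
  have sum4: "(P + Q + (R + S)) $$ (?k, ?k) = P $$ (?k, ?k) + Q $$ (?k, ?k) +
      (R $$ (?k, ?k) + S $$ (?k, ?k))"
    if "P \<in> carrier_mat (2 * N) (2 * N)" "Q \<in> carrier_mat (2 * N) (2 * N)"
      "R \<in> carrier_mat (2 * N) (2 * N)" "S \<in> carrier_mat (2 * N) (2 * N)"
    for P Q R S :: "complex mat"
    using that k carrier_matD[OF that(2)] carrier_matD[OF that(4)] by simp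
  \<comment> \<open>Of the four products, the two middle ones contain \<open>mode\<close> times
    \<open>Z\<close>, whose diagonal is zero.\<close>
  have "(majorana ws * majorana vs) $$ (?k, ?k) =
      (mode w * mode v) $$ (of_bool z, of_bool z) * (1\<^sub>m N * 1\<^sub>m N) $$ (i, i) +
      (mode w * pauli_Z) $$ (of_bool z, of_bool z) * (1\<^sub>m N * ?M') $$ (i, i) +
      ((pauli_Z * mode v) $$ (of_bool z, of_bool z) * (?M * 1\<^sub>m N) $$ (i, i) +
      (pauli_Z * pauli_Z) $$ (of_bool z, of_bool z) * (?M * ?M') $$ (i, i))"
    unfolding ws majorana.simps len N_def[symmetric] distr[OF X Y[OF M(1)] X Y[OF M(2)]]
    by (subst sum4; (intro mult_carrier_mat[where n = "2 * N"] X Y M)?)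
      (simp only: prod[OF mat22_carrier one_carrier_mat mat22_carrier one_carrier_mat]
        prod[OF mat22_carrier one_carrier_mat mat22_carrier M(2)]
        prod[OF mat22_carrier M(1) mat22_carrier one_carrier_mat]
        prod[OF mat22_carrier M(1) mat22_carrier M(2)])
  also have "\<dots> = (if z then cnj w * v else w * cnj v) + (?M * ?M') $$ (i, i)"
    using i by (simp add: mat22_mult del: index_mult_mat(1)) 
  also have "(?M * ?M') $$ (i, i) =
      (\<Sum>j<length zs. if zs ! j then cnj (ws' ! j) * vs' ! j else ws' ! j * cnj (vs' ! j))"
    unfolding i_def by (rule Cons.IH[OF len])
  finally show ?case
    unfolding ws by (simp add: sum.lessThan_Suc_shift i_def N_def cong: if_cong del: sum.lessThan_Suc)
qed

section \<open>Measurement of the first qubit\<close>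

lemma sum_lessThan_add:
  fixes g :: "nat \<Rightarrow> 'a :: comm_monoid_add"
  shows "(\<Sum>i<a + b. g i) = (\<Sum>i<a. g i) + (\<Sum>i<b. g (a + i))"
  by (induction b) (simp_all add: add.assoc)

lemma bit_strings_Suc:
  "{ys. length ys = Suc r \<and> hd ys = b} = (#) b ` {ys. length ys = r}"
  by (auto simp: length_Suc_conv)

lemma finite_bit_strings: "finite {ys :: bool list. length ys = r}"
  using finite_lists_length_eq[of "UNIV :: bool set" r] by simp

text \<open>\<open>basis_index\<close> enumerates the indices: strings starting with
  \<open>False\<close> give the lower half and those starting with \<open>True\<close> the upper
  half.\<close>

lemma sum_bit_strings:
  fixes g :: "nat \<Rightarrow> 'a :: comm_monoid_add"
  shows "(\<Sum>ys | length ys = r. g (basis_index ys)) = (\<Sum>i<2 ^ r. g i)"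
proof (induction r arbitrary: g)
  case (Suc r)
  have eq: "{ys. length ys = Suc r} =
      (#) False ` {ys. length ys = r} \<union> (#) True ` {ys. length ys = r}"
    by (auto simp: length_Suc_conv)
  have "(\<Sum>ys | length ys = Suc r. g (basis_index ys)) =
      (\<Sum>ys | length ys = r. g (basis_index (False # ys))) +
      (\<Sum>ys | length ys = r. g (basis_index (True # ys)))"
    unfolding eq by (subst sum.union_disjoint) (auto simp: finite_bit_strings sum.reindex)
  also have "(\<Sum>ys | length ys = r. g (basis_index (False # ys))) = (\<Sum>i<2 ^ r. g i)"
    using Suc.IH[of g] by simp
  also have "(\<Sum>ys | length ys = r. g (basis_index (True # ys))) = (\<Sum>i<2 ^ r. g (2 ^ r + i))"
    using Suc.IH[of "\<lambda>i. g (2 ^ r + i)"] by simp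
  finally show ?case
    by (simp add: sum_lessThan_add[symmetric] mult_2)
qed simp

lemma prob_first_Suc:
  "prob_first (Suc r) \<psi> b = (\<Sum>i<2 ^ r. (cmod (\<psi> $ (of_bool b * 2 ^ r + i)))\<^sup>2)"
proof -
  have "prob_first (Suc r) \<psi> b =
      (\<Sum>ys | length ys = r. (cmod (\<psi> $ (of_bool b * 2 ^ r + basis_index ys)))\<^sup>2)"
    unfolding prob_first_def bit_strings_Suc by (subst sum.reindex) auto
  also have "\<dots> = (\<Sum>i<2 ^ r. (cmod (\<psi> $ (of_bool b * 2 ^ r + i)))\<^sup>2)"
    by (rule sum_bit_strings)
  finally show ?thesis .
qed

lemma majorana_zero: "majorana (replicate r 0) = 0\<^sub>m (2 ^ r) (2 ^ r)"
proof (induction r)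
  case (Suc r)
  have "mode 0 = 0\<^sub>m 2 2"
    by (rule eq_matI) (auto simp: less_2_cases_iff)
  then have "majorana (replicate (Suc r) 0) =
      0\<^sub>m (2 * 2 ^ r) (2 * 2 ^ r) + 0\<^sub>m (2 * 2 ^ r) (2 * 2 ^ r)"
    by (simp add: Suc.IH zero_kron kron_zero)
  also have "\<dots> = 0\<^sub>m (2 * 2 ^ r) (2 * 2 ^ r)"
    by (rule left_add_zero_mat) simp
  finally show ?case
    by simp
qed simp

lemma majorana_first:
  "majorana (w # replicate r 0) = mode w \<otimes>\<^sub>k 1\<^sub>m (2 ^ r)"
proof -
  have "mode w \<otimes>\<^sub>k 1\<^sub>m (2 ^ r) \<in> carrier_mat (2 * 2 ^ r) (2 * 2 ^ r)"
    by (intro kron_carrier) auto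
  then show ?thesis
    by (simp add: majorana_zero kron_zero)
qed

text \<open>The coefficients 1 and -i encode X and Y, and X Y = i Z. This product is therefore i
  times the observable measured on the first qubit.\<close>

lemma majorana_first_mult:
  "majorana (1 # replicate r 0) * majorana (- \<i> # replicate r 0) =
    mat (2 ^ Suc r) (2 ^ Suc r) (\<lambda>(i, j). if i = j then if i < 2 ^ r then \<i> else - \<i> else 0)"
proof -
  have "majorana (1 # replicate r 0) * majorana (- \<i> # replicate r 0) =
      (mode 1 * mode (- \<i>)) \<otimes>\<^sub>k (1\<^sub>m (2 ^ r) * 1\<^sub>m (2 ^ r))"
    unfolding majorana_first by (rule kron_mult_kron) auto
  also have "\<dots> = mat22 \<i> 0 0 (- \<i>) \<otimes>\<^sub>k 1\<^sub>m (2 ^ r)"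
    by (simp add: mat22_mult)
  also have "\<dots> = mat (2 ^ Suc r) (2 ^ Suc r)
      (\<lambda>(i, j). if i = j then if i < 2 ^ r then \<i> else - \<i> else 0)" (is "?L = ?R")
  proof (rule eq_matI)
    fix i j
    assume "i < dim_row ?R" "j < dim_col ?R"
    then have ij: "i < 2 * 2 ^ r" "j < 2 * 2 ^ r"
      by auto
    have d: "p div 2 ^ r = of_bool (\<not> p < 2 ^ r)" if "p < 2 * 2 ^ r" for p :: nat
      using that by (auto simp: not_less intro!: div_nat_eqI)
    have "i = j" if "i div 2 ^ r = j div 2 ^ r" "i mod 2 ^ r = j mod 2 ^ r"
      using that by (metis div_mult_mod_eq)
    then show "?L $$ (i, j) = ?R $$ (i, j)"
      using ij d[OF ij(1)] d[OF ij(2)] by (auto simp: kron_index)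
  qed auto
  finally show ?thesis .
qed

lemma mult_ket:
  assumes "U \<in> carrier_mat (2 ^ length zs) (2 ^ length zs)" "i < 2 ^ length zs"
  shows "(U *\<^sub>v ket zs) $ i = U $$ (i, basis_index zs)"
  using assms basis_index_less[of zs] by (auto simp: ket_def)

lemma unitary_mat_left:
  assumes "unitary_mat N U"
  shows "mat_adjoint U * U = 1\<^sub>m N" "mat_adjoint U \<in> carrier_mat N N" "U \<in> carrier_mat N N"
proof -
  show c: "mat_adjoint U \<in> carrier_mat N N" "U \<in> carrier_mat N N"
    using assms by (auto simp: unitary_mat_def)
  show "mat_adjoint U * U = 1\<^sub>m N"
    using assms c by (auto simp: unitary_mat_def intro: mat_mult_left_right_inverse)
qed

text \<open>\<open>U *\<^sub>v ket zs\<close> is a column of \<open>U\<close>, and its squared norm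
  is a diagonal entry of \<open>mat_adjoint U * U\<close>.\<close>

lemma prob_first_total:
  assumes "unitary_mat (2 ^ m) U" "length zs = m" "m \<ge> 1"
  shows "prob_first m (U *\<^sub>v ket zs) False + prob_first m (U *\<^sub>v ket zs) True = 1"
proof -
  obtain r where m: "m = Suc r"
    using assms(3) by (cases m) auto
  let ?t = "basis_index zs"
  note U = unitary_mat_left[OF assms(1)]
  have t: "?t < 2 ^ m"
    using basis_index_less assms(2) by blast
  have "complex_of_real (\<Sum>i<2 ^ m. (cmod (U $$ (i, ?t)))\<^sup>2) = (mat_adjoint U * U) $$ (?t, ?t)"
    using U(2,3) t carrier_matD[OF U(3)]
    by (simp add: scalar_prod_def index_mat_adjoint of_real_sum lessThan_atLeast0 mult.commute
        complex_norm_square del: of_real_power)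
  also have "\<dots> = of_real 1"
    using t by (simp add: U(1))
  finally have "(\<Sum>i<2 ^ m. (cmod (U $$ (i, ?t)))\<^sup>2) = 1"
    by (simp only: of_real_eq_iff)
  moreover have "(\<Sum>i<2 ^ m. (cmod (U $$ (i, ?t)))\<^sup>2) =
      (\<Sum>i<2 ^ r. (cmod (U $$ (i, ?t)))\<^sup>2) + (\<Sum>i<2 ^ r. (cmod (U $$ (2 ^ r + i, ?t)))\<^sup>2)"
    by (simp add: m mult_2 sum_lessThan_add)
  ultimately show ?thesis
    using U(3) assms(2) by (simp add: m prob_first_Suc mult_ket del: index_mult_mat_vec)
qed

text \<open>The difference is the expectation of Z on the first qubit, that is, -i times that of X
  Y; the hypotheses carry X and Y through the circuit.\<close>

lemma prob_first_diff:
  assumes "unitary_mat (2 ^ m) U" "length zs = m" "m = Suc r"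
    and "length ws = m" "length vs = m"
    and ws: "majorana (1 # replicate r 0) * U = U * majorana ws"
    and vs: "majorana (- \<i> # replicate r 0) * U = U * majorana vs"
  shows "prob_first m (U *\<^sub>v ket zs) False - prob_first m (U *\<^sub>v ket zs) True =
    (\<Sum>j<m. (if zs ! j then - 1 else 1) * Im (ws ! j * cnj (vs ! j)))"
proof -
  let ?t = "basis_index zs" and ?N = "2 ^ m :: nat"
  let ?p = "\<lambda>i. (cmod (U $$ (i, ?t)))\<^sup>2" and ?s = "\<lambda>i. if i < 2 ^ r then 1 else - 1 :: real"
  define A where "A = majorana (1 # replicate r 0)"
  define B where "B = majorana (- \<i> # replicate r 0)"
  note U = unitary_mat_left[OF assms(1)]
  have t: "?t < ?N"
    using basis_index_less assms(2) by blast
  have c: "A \<in> carrier_mat ?N ?N" "B \<in> carrier_mat ?N ?N"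
    "majorana ws \<in> carrier_mat ?N ?N" "majorana vs \<in> carrier_mat ?N ?N"
    unfolding A_def B_def using majorana_carrier assms(3-5) by (metis length_Cons length_replicate)+
  note assoc = assoc_mult_mat[where n\<^sub>1 = ?N and n\<^sub>2 = ?N and n\<^sub>3 = ?N and n\<^sub>4 = ?N]
  \<comment> \<open>First \<open>B\<close> and then \<open>A\<close> is moved through
    \<open>U\<close>, after which \<open>U\<close> meets its adjoint and cancels.\<close>
  have "mat_adjoint U * ((A * B) * U) = mat_adjoint U * (A * (B * U))"
    using c U by (simp add: assoc)
  also have "\<dots> = mat_adjoint U * ((A * U) * majorana vs)"
    unfolding B_def vs using c U by (simp add: assoc)
  also have "\<dots> = mat_adjoint U * (U * (majorana ws * majorana vs))"
    unfolding A_def ws using c U by (simp add: assoc)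
  also have "\<dots> = (mat_adjoint U * U) * (majorana ws * majorana vs)"
    by (rule assoc[OF U(2,3) mult_carrier_mat[OF c(3,4)], symmetric])
  also have "\<dots> = majorana ws * majorana vs"
    unfolding U(1) by (rule left_mult_one_mat[OF mult_carrier_mat[OF c(3,4)]])
  finally have eq: "mat_adjoint U * ((A * B) * U) = majorana ws * majorana vs" .
  have AB: "A * B = mat ?N ?N (\<lambda>(i, j). if i = j then \<i> * ?s i else 0)"
    unfolding A_def B_def majorana_first_mult assms(3) by (rule eq_matI) auto
  have ABU: "((A * B) * U) $$ (i, ?t) = \<i> * ?s i * U $$ (i, ?t)" if "i < ?N" for i
    unfolding AB using that t carrier_matD[OF U(3)]
    by (simp add: scalar_prod_def if_distrib[of "\<lambda>x. x * _"] cong: if_cong)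
  have "(mat_adjoint U * ((A * B) * U)) $$ (?t, ?t) =
      (\<Sum>i<?N. cnj (U $$ (i, ?t)) * (\<i> * ?s i * U $$ (i, ?t)))"
  proof -
    have "dim_row (A * B * U) = ?N" "dim_col (A * B * U) = ?N"
      using c carrier_matD[OF U(3)] by auto
    then have "(mat_adjoint U * ((A * B) * U)) $$ (?t, ?t) =
      (\<Sum>i<?N. cnj (U $$ (i, ?t)) * ((A * B) * U) $$ (i, ?t))"
      using t carrier_matD[OF U(3)]
      by (simp add: scalar_prod_def index_mat_adjoint lessThan_atLeast0 del: index_mult_mat(1)
          add: index_mult_mat(1)[of _ "mat_adjoint U"])
    then show ?thesis
      by (simp add: ABU)
  qed
  also have "\<dots> = (\<Sum>i<?N. \<i> * of_real (?s i * ?p i))"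
    by (intro sum.cong refl) (simp add: complex_norm_square mult_ac del: of_real_power)
  finally have "(majorana ws * majorana vs) $$ (?t, ?t) = \<i> * of_real (\<Sum>i<?N. ?s i * ?p i)"
    unfolding eq by (simp add: sum_distrib_left)
  then have "(\<Sum>i<?N. ?s i * ?p i) = Im ((majorana ws * majorana vs) $$ (?t, ?t))"
    by simp
  \<comment> \<open>For a set bit the diagonal term is the complex conjugate of the one for a clear
    bit, which turns into a sign under \<open>Im\<close>.\<close>
  also have "\<dots> = (\<Sum>j<m. (if zs ! j then - 1 else 1) * Im (ws ! j * cnj (vs ! j)))"
    using assms(2,4,5) by (auto simp: majorana_mult_diag intro!: sum.cong)
  finally have "(\<Sum>i<?N. ?s i * ?p i) =
    (\<Sum>j<m. (if zs ! j then - 1 else 1) * Im (ws ! j * cnj (vs ! j)))" .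
  moreover have "(\<Sum>i<?N. ?s i * ?p i) = (\<Sum>i<2 ^ r. ?p i) - (\<Sum>i<2 ^ r. ?p (2 ^ r + i))"
    by (simp add: assms(3) mult_2 sum_lessThan_add sum_negf)
  moreover have "prob_first m (U *\<^sub>v ket zs) False - prob_first m (U *\<^sub>v ket zs) True =
      (\<Sum>i<2 ^ r. ?p i) - (\<Sum>i<2 ^ r. ?p (2 ^ r + i))"
    using U(3) assms(2,3) by (simp add: prob_first_Suc mult_ket del: index_mult_mat_vec)
  ultimately show ?thesis
    by simp
qed

section \<open>Bias of the first qubit and dependence on bits\<close>

lemma prob_first_bias:
  assumes "matchgate_circuit m U" "m \<ge> 1"
  shows "\<exists>h. (\<Sum>j<m. \<bar>h j\<bar>) \<le> 1 \<and> (\<forall>zs. length zs = m \<longrightarrow>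
    prob_first m (U *\<^sub>v ket zs) False - prob_first m (U *\<^sub>v ket zs) True =
      (\<Sum>j<m. (if zs ! j then - 1 else 1) * h j))"
proof -
  obtain r where m: "m = Suc r"
    using assms(2) by (cases m) auto
  note U = unitary_mat_matchgate_circuit[OF assms(1)]
  have len: "length (c # replicate r 0) = m" for c :: complex
    by (simp add: m)
  have norm: "(\<Sum>j<m. (cmod ((c # replicate r 0) ! j))\<^sup>2) = (cmod c)\<^sup>2" for c
    by (simp add: m sum.lessThan_Suc_shift del: sum.lessThan_Suc)
  obtain ws where ws: "length ws = m" "(\<Sum>j<m. (cmod (ws ! j))\<^sup>2) = 1"
    "majorana (1 # replicate r 0) * U = U * majorana ws"
    using majorana_circuit[OF assms(1) len[of 1]] unfolding norm by auto
  obtain vs where vs: "length vs = m" "(\<Sum>j<m. (cmod (vs ! j))\<^sup>2) = 1"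
    "majorana (- \<i> # replicate r 0) * U = U * majorana vs"
    using majorana_circuit[OF assms(1) len[of "- \<i>"]] unfolding norm by auto
  \<comment> \<open>These weights come from the circuit alone, so the same \<open>h\<close> serves
    every input.\<close>
  let ?h = "\<lambda>j. Im (ws ! j * cnj (vs ! j))"
  \<comment> \<open>Arithmetic-geometric mean term by term: both coefficient lists have squared norm
    1, so the bounds add up to 1.\<close>
  have "\<bar>?h j\<bar> \<le> ((cmod (ws ! j))\<^sup>2 + (cmod (vs ! j))\<^sup>2) / 2" for j
  proof -
    have "\<bar>?h j\<bar> \<le> cmod (ws ! j) * cmod (vs ! j)"
      using abs_Im_le_cmod[of "ws ! j * cnj (vs ! j)"] by (simp add: norm_mult)
    also have "\<dots> \<le> ((cmod (ws ! j))\<^sup>2 + (cmod (vs ! j))\<^sup>2) / 2"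
      using sum_squares_bound[of "cmod (ws ! j)" "cmod (vs ! j)"] by simp
    finally show ?thesis .
  qed
  then have "(\<Sum>j<m. \<bar>?h j\<bar>) \<le> (\<Sum>j<m. ((cmod (ws ! j))\<^sup>2 + (cmod (vs ! j))\<^sup>2) / 2)"
    by (intro sum_mono)
  also have "\<dots> = 1"
    by (simp add: sum_divide_distrib[symmetric] sum.distrib ws(2) vs(2))
  finally show ?thesis
    using prob_first_diff[OF U _ m ws(1) vs(1) ws(3) vs(3)] by (intro exI[of _ ?h]) blast
qed

lemma not_depends_on_two:
  assumes "p > 3 / 4" "computes n m U f p" "matchgate_circuit m U" "n \<le> m"
    and "depends_on n f k" "depends_on n f l"
  shows "k = l"
proof (rule ccontr)
  assume "k \<noteq> l"
  have kl: "k < n" "l < n"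
    using assms(5,6) by (auto simp: depends_on_def)
  then have m: "m \<ge> 1"
    using assms(4) by simp
  obtain h where h: "(\<Sum>j<m. \<bar>h j\<bar>) \<le> 1" and diff: "\<And>zs. length zs = m \<Longrightarrow>
    prob_first m (U *\<^sub>v ket zs) False - prob_first m (U *\<^sub>v ket zs) True =
      (\<Sum>j<m. (if zs ! j then - 1 else 1) * h j)"
    using prob_first_bias[OF assms(3) m] by blast
  note total = prob_first_total[OF unitary_mat_matchgate_circuit[OF assms(3)] _ m]
  define E where "E xs = (\<Sum>j<m. (if (xs @ replicate (m - n) False) ! j then - 1 else 1) * h j)"
    for xs
  \<comment> \<open>The two probabilities sum to 1, so a success probability above 3/4 leaves a
    difference above 3/4 - 1/4.\<close>
  have E: "if f xs then E xs < - 1 / 2 else E xs > 1 / 2" if "length xs = n" for xs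
  proof -
    let ?zs = "xs @ replicate (m - n) False"
    have len: "length ?zs = m"
      using that assms(4) by simp
    have "prob_first m (U *\<^sub>v ket ?zs) (f xs) > 3 / 4"
      using assms(1,2) that unfolding computes_def by fastforce
    then show ?thesis
      using diff[OF len] total[OF len] unfolding E_def by (cases "f xs") auto
  qed
  \<comment> \<open>Flipping bit \<open>i\<close> changes only the \<open>i\<close>-th term of
    \<open>E\<close>, by \<open>2 * h i\<close> up to sign. If \<open>f\<close> changes too,
    \<open>E\<close> must jump across the whole interval from -1/2 to 1/2.\<close>
  have large: "\<bar>h i\<bar> > 1 / 2" if dep: "depends_on n f i" for i
  proof -
    obtain xs where xs: "length xs = n" "f xs \<noteq> f (xs[i := \<not> xs ! i])" and i: "i < n"
      using dep unfolding depends_on_def by blast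
    let ?ys = "xs[i := \<not> xs ! i]"
    have im: "i < m"
      using i assms(4) by simp
    have "E xs = (if xs ! i then - 1 else 1) * h i +
        (\<Sum>j\<in>{..<m} - {i}. (if (xs @ replicate (m - n) False) ! j then - 1 else 1) * h j)"
      unfolding E_def using im i xs(1)
      by (subst sum.remove[of _ i]) (auto simp: nth_append)
    moreover have "E ?ys = (if xs ! i then 1 else - 1) * h i +
        (\<Sum>j\<in>{..<m} - {i}. (if (?ys @ replicate (m - n) False) ! j then - 1 else 1) * h j)"
      unfolding E_def using im i xs(1)
      by (subst sum.remove[of _ i]) (auto simp: nth_append)
    moreover have "(\<Sum>j\<in>{..<m} - {i}. (if (?ys @ replicate (m - n) False) ! j then - 1 else 1) * h j) =
        (\<Sum>j\<in>{..<m} - {i}. (if (xs @ replicate (m - n) False) ! j then - 1 else 1) * h j)"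
      by (intro sum.cong refl) (auto simp: nth_append)
    ultimately have "E xs - E ?ys = 2 * (if xs ! i then - 1 else 1) * h i"
      by simp
    then have "\<bar>E xs - E ?ys\<bar> = 2 * \<bar>h i\<bar>"
      by (simp add: abs_mult)
    moreover have "\<bar>E xs - E ?ys\<bar> > 1"
      using E[of xs] E[of ?ys] xs by (auto split: if_splits)
    ultimately show ?thesis
      by simp
  qed
  have "\<bar>h k\<bar> + \<bar>h l\<bar> = (\<Sum>j\<in>{k, l}. \<bar>h j\<bar>)"
    using \<open>k \<noteq> l\<close> by simp
  also have "\<dots> \<le> (\<Sum>j<m. \<bar>h j\<bar>)"
    using kl assms(4) by (intro sum_mono2) auto
  finally show False
    using h large[OF assms(5)] large[OF assms(6)] by simp
qed

text \<open>Hybrid argument: the bits of \<open>xs\<close> are replaced by those of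
  \<open>ys\<close> one at a time, and a bit that really changes is one on which \<open>f\<close>
  does not depend.\<close>

lemma independent_imp_agree:
  assumes "length xs = n" "length ys = n"
    and "\<And>k. depends_on n f k \<Longrightarrow> xs ! k = ys ! k"
  shows "f xs = f ys"
proof -
  have "f (take i ys @ drop i xs) = f xs" if "i \<le> n" for i
    using that
  proof (induction i)
    case (Suc i)
    let ?zs = "take i ys @ drop i xs"
    have i: "i < n"
      using Suc.prems by simp
    have zs: "length ?zs = n" "?zs ! i = xs ! i"
      using i assms(1,2) by (simp_all add: nth_append)
    have upd: "take (Suc i) ys @ drop (Suc i) xs = ?zs[i := ys ! i]"
      using i assms(1,2)
      by (simp add: take_Suc_conv_app_nth list_update_append Cons_nth_drop_Suc[symmetric])
    have "f (?zs[i := ys ! i]) = f ?zs"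
    proof (cases "xs ! i = ys ! i")
      case True
      then show ?thesis
        using list_update_id[of ?zs i] unfolding zs(2) by simp
    next
      case False
      then have "\<not> depends_on n f i" and flip: "ys ! i = (\<not> ?zs ! i)"
        using assms(3) zs(2) by auto
      then have "f ?zs = f (?zs[i := \<not> ?zs ! i])"
        using i zs(1) unfolding depends_on_def by blast
      then show ?thesis
        unfolding flip by simp
    qed
    then show ?case
      using Suc upd by simp
  qed simp
  from this[of n] show ?thesis
    using assms(1,2) by simp
qed

section \<open>Circuits selecting a bit\<close>

lemma image_swap:
  "image_left 1 0 0 1 w w' = w'" "image_right 1 0 0 1 w w' = - w"
  by (simp_all add: image_left_def image_right_def)

text \<open>The gate flips both qubits up to signs; \<open>w\<close> becoming \<open>- cnj w\<close>
  means that X changes sign and Y does not, so Z is negated.\<close>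

lemma image_flip:
  "image_left 0 1 0 1 w w' = - cnj w" "image_right 0 1 0 1 w w' = - cnj w'"
  by (simp_all add: image_left_def image_right_def)

text \<open>A chain of signed swaps carries the coefficient from \<open>j\<close> to
  \<open>k\<close>, each one contributing a factor -1. One sign \<open>s\<close> serves all
  \<open>c\<close>, so it squares away in a product of two operators.\<close>

lemma swap_circuit:
  assumes "j \<le> k" "k < m"
  shows "\<exists>U s. matchgate_circuit m U \<and> s\<^sup>2 = 1 \<and> (\<forall>c.
    majorana ((replicate m 0)[j := c]) * U = U * majorana ((replicate m 0)[k := of_real s * c]))"
  using assms
proof (induction rule: inc_induct)
  case base
  have "majorana ((replicate m 0)[k := c]) \<in> carrier_mat (2 ^ m) (2 ^ m)" for c
    using majorana_carrier[of "(replicate m 0)[k := c]"] by simp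
  then show ?case
    by (intro exI[of _ "1\<^sub>m (2 ^ m)"] exI[of _ 1]) (auto intro: matchgate_circuit.empty)
next
  case (step j)
  obtain U s where U: "matchgate_circuit m U" "s\<^sup>2 = 1"
    "\<And>c. majorana ((replicate m 0)[Suc j := c]) * U = U * majorana ((replicate m 0)[k := of_real s * c])"
    using step by blast
  let ?G = "matchgate_of 1 0 0 1"
  let ?us = "replicate j (0 :: complex)" and ?rs = "replicate (m - j - 2) (0 :: complex)"
  have G: "matchgate ?G"
    unfolding matchgate_iff by (intro exI[of _ 1] exI[of _ 0]) auto
  have m: "m = length ?us + 2 + length ?rs"
    using step by simp
  have "replicate m (0 :: complex) = ?us @ [0, 0] @ ?rs"
    using m by (simp add: replicate_add[symmetric] flip: replicate_Suc)
  then have rep: "(replicate m 0)[j := c] = ?us @ [c, 0] @ ?rs"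
    "(replicate m 0)[Suc j := c] = ?us @ [0, c] @ ?rs" for c :: complex
    by (simp_all add: list_update_append)
  have "majorana ((replicate m 0)[j := c]) * (on_neighbours m j ?G * U) =
      on_neighbours m j ?G * U * majorana ((replicate m 0)[k := of_real (- s) * c])" for c
    using majorana_gate_circuit[OF U(1) _ _ _ m,
        of "(replicate m 0)[k := of_real (- s) * c]" 1 0 0 1 c 0]
      U(3)[of "- c"]
    by (simp add: image_swap rep)
  moreover have "matchgate_circuit m (on_neighbours m j ?G * U)"
    using G U(1) step by (intro matchgate_circuit.gate) auto
  ultimately show ?case
    using U(2) by (intro exI[of _ "on_neighbours m j ?G * U"] exI[of _ "- s"]) auto
qed

lemma select_circuit:
  assumes "k < m" "m \<ge> 2"
  shows "\<exists>U. matchgate_circuit m U \<and> (\<forall>zs. length zs = m \<longrightarrow>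
    prob_first m (U *\<^sub>v ket zs) (if neg then \<not> zs ! k else zs ! k) = 1)"
proof -
  obtain r where m: "m = Suc r"
    using assms(1) by (cases m) auto
  have first: "c # replicate r 0 = (replicate m 0)[0 := c]" for c :: complex
    by (simp add: m)
  \<comment> \<open>The effect on the first coefficient of the optional flip, which is applied after
    all swaps.\<close>
  define tau where "tau c = (if neg then - cnj c else c)" for c
  obtain U s where U: "matchgate_circuit m U" "s\<^sup>2 = 1"
    "\<And>c. majorana ((replicate m 0)[0 := c]) * U = U * majorana ((replicate m 0)[k := of_real s * tau c])"
  proof -
    obtain U s where U: "matchgate_circuit m U" "s\<^sup>2 = 1"
      "\<And>c. majorana ((replicate m 0)[0 := c]) * U = U * majorana ((replicate m 0)[k := of_real s * c])"
      using swap_circuit[of 0 k m] assms by auto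
    show ?thesis
    proof (cases neg)
      case False
      then show ?thesis
        using that[of U s] U by (simp add: tau_def)
    next
      case True
      let ?G = "matchgate_of 0 1 0 1" and ?rs = "replicate (m - 2) (0 :: complex)"
      have G: "matchgate ?G"
        unfolding matchgate_iff by (intro exI[of _ 0] exI[of _ 1]) auto
      have len: "m = length ([] :: complex list) + 2 + length ?rs"
        using assms by simp
      have rep: "(replicate m 0)[0 := c] = [] @ [c, 0] @ ?rs" for c :: complex
        using assms by (cases m; cases "m - 1") auto
      have "majorana ((replicate m 0)[0 := c]) * (on_neighbours m 0 ?G * U) =
          on_neighbours m 0 ?G * U * majorana ((replicate m 0)[k := of_real s * tau c])" for c
        using majorana_gate_circuit[OF U(1) _ _ _ len,
            of "(replicate m 0)[k := of_real s * - cnj c]" 0 1 0 1 c 0] U(3)[of "- cnj c"]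
        by (simp add: image_flip rep tau_def True)
      moreover have "matchgate_circuit m (on_neighbours m 0 ?G * U)"
        using G U(1) assms by (intro matchgate_circuit.gate) auto
      ultimately show ?thesis
        using that U(2) by blast
    qed
  qed
  have "prob_first m (U *\<^sub>v ket zs) (if neg then \<not> zs ! k else zs ! k) = 1"
    if len: "length zs = m" for zs
  proof -
    note unitary = unitary_mat_matchgate_circuit[OF U(1)]
    let ?ws = "(replicate m 0)[k := of_real s * tau 1]"
    let ?vs = "(replicate m 0)[k := of_real s * tau (- \<i>)]"
    have "prob_first m (U *\<^sub>v ket zs) False - prob_first m (U *\<^sub>v ket zs) True =
        (\<Sum>j<m. (if zs ! j then - 1 else 1) * Im (?ws ! j * cnj (?vs ! j)))"
      using U(3) by (intro prob_first_diff[OF unitary len m]) (auto simp: first)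
    also have "\<dots> = (if zs ! k then - 1 else 1) * Im (?ws ! k * cnj (?vs ! k))"
      using assms(1) by (subst sum.remove[of _ k]) (auto intro!: sum.neutral)
    also have "?ws ! k * cnj (?vs ! k) = of_real (s\<^sup>2) * (tau 1 * cnj (tau (- \<i>)))"
      using assms(1) by (simp add: power2_eq_square mult_ac)
    also have "Im (of_real (s\<^sup>2) * (tau 1 * cnj (tau (- \<i>)))) = (if neg then - 1 else 1)"
      by (simp add: U(2) tau_def)
    \<comment> \<open>The difference is 1 or -1 and the probabilities sum to 1, so the outcome is
      certain.\<close>
    finally show ?thesis
      using prob_first_total[OF unitary len] assms by (auto split: if_splits)
  qed
  then show ?thesis
    using U(1) by blast
qed

text \<open>One ancilla is appended: \<open>k = n\<close> selects it and yields the constants, and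
  it ensures the two qubits that the flip needs.\<close>

lemma computable_if_bit:
  assumes "n \<ge> 1" "k \<le> n"
    and "\<And>xs. length xs = n \<Longrightarrow> f xs = (if neg then \<not> (xs @ [False]) ! k else (xs @ [False]) ! k)"
  shows "matchgate_computable n f 1"
proof -
  obtain U where U: "matchgate_circuit (Suc n) U" "\<And>zs. length zs = Suc n \<Longrightarrow>
    prob_first (Suc n) (U *\<^sub>v ket zs) (if neg then \<not> zs ! k else zs ! k) = 1"
    using select_circuit[of k "Suc n" neg] assms by auto
  then have "computes n (Suc n) U f 1"
    unfolding computes_def using assms(3) by simp
  then show ?thesis
    unfolding matchgate_computable_def using U(1) by (intro exI[of _ "Suc n"] exI[of _ U]) simp
qed

theorem theorem2:
  fixes n :: nat and f :: "bool list \<Rightarrow> bool"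
  assumes "n \<ge> 1"
  shows "(\<exists>p::real. p > 3 / 4 \<and> matchgate_computable n f p) \<longleftrightarrow>
    constant_function n f \<or> depends_on_single_bit n f"
proof
  assume "\<exists>p::real. p > 3 / 4 \<and> matchgate_computable n f p"
  then have uniq: "k = l" if "depends_on n f k" "depends_on n f l" for k l
    using not_depends_on_two that unfolding matchgate_computable_def by blast
  show "constant_function n f \<or> depends_on_single_bit n f"
  proof (cases "\<exists>k. depends_on n f k")
    case True
    then show ?thesis
      using uniq unfolding depends_on_single_bit_def by blast
  next
    case False
    then have "f xs = f (replicate n False)" if "length xs = n" for xs
      using independent_imp_agree[of xs n "replicate n False" f] that by auto
    then show ?thesis
      unfolding constant_function_def by blast
  qed
next
  assume "constant_function n f \<or> depends_on_single_bit n f"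
  then have "matchgate_computable n f 1"
  proof
    assume "constant_function n f"
    then obtain c where "\<And>xs. length xs = n \<Longrightarrow> f xs = c"
      unfolding constant_function_def by blast
    then show ?thesis
      using assms by (intro computable_if_bit[of n n f c]) (auto simp: nth_append)
  next
    assume "depends_on_single_bit n f"
    then obtain k where k: "depends_on n f k" "\<And>l. depends_on n f l \<Longrightarrow> l = k"
      unfolding depends_on_single_bit_def by blast
    then obtain xs where xs: "length xs = n" "f xs \<noteq> f (xs[k := \<not> xs ! k])" "k < n"
      unfolding depends_on_def by blast
    \<comment> \<open>\<open>f\<close> is determined by bit \<open>k\<close>: its value is that at
      \<open>xs\<close> exactly when \<open>ys\<close> agrees with \<open>xs\<close> there.\<close>
    have "f ys = (f xs \<noteq> (xs ! k \<noteq> ys ! k))" if "length ys = n" for ys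
    proof (cases "xs ! k = ys ! k")
      case True
      then show ?thesis
        using independent_imp_agree[OF that xs(1), of f] k(2) by metis
    next
      case False
      have "f ys = f (xs[k := \<not> xs ! k])"
      proof (rule independent_imp_agree[OF that])
        fix l
        assume "depends_on n f l"
        then have "l = k"
          by (rule k(2))
        then show "ys ! l = xs[k := \<not> xs ! k] ! l"
          using False xs(1,3) by simp
      qed (simp add: xs(1))
      then show ?thesis
        using xs(2) False by auto
    qed
    then show ?thesis
      using assms xs(3)
      \<comment> \<open>The output is the negated bit exactly when \<open>f xs\<close> differs from
        \<open>xs ! k\<close>.\<close>
      by (intro computable_if_bit[of n k f "f xs \<noteq> xs ! k"]) (auto simp: nth_append)
  qed
  then show "\<exists>p::real. p > 3 / 4 \<and> matchgate_computable n f p"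
    by (intro exI[of _ 1]) simp
qed

end
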